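(* Let $X$ be a locally finite poset, $K$ a field and $\lambda\in\mathrm{Aut}(X)$. If $\sigma,\sigma'\in I(X,K)$ are equivalent multiplicative elements, then $H^n_{(\sigma,\lambda)}(X,K)\cong H^n_{(\sigma',\lambda)}(X,K)$ as $K$-spaces for all $n\ge 0$.
   Context: A poset is locally finite if all its intervals $\{z: x\le z\le y\}$ are finite. $\mathrm{Aut}(X)$ is the group of bijections $\lambda:X\to X$ with $x\le y\iff\lambda(x)\le\lambda(y)$. The incidence algebra $I(X,K)$ is the $K$-space of functions $f:X\times X\to K$ with $f(x,y)=0$ for $x\nleq y$, with product $(fg)(x,y)=\sum_{x\le z\le y}f(x,z)g(z,y)$. An element $\sigma\in I(X,K)$ is multiplicative if $\sigma(x,y)\ne 0$ for all $x\le y$ and $\sigma(x,z)=\sigma(x,y)\sigma(y,z)$ whenever $x\le y\le z$. A multiplicative $\eta\in I(X,K)$ is fractional if there is $\gamma:X\to K^*$ with $\eta(x,y)=\gamma(x)\gamma(y)^{-1}$ for all $x\le y$. Two multiplicative elements $\sigma,\sigma'$ are equivalent if there is a fractional $\eta$ with $\sigma'=\sigma*\eta$, where $(\sigma*\eta)(x,y)=\sigma(x,y)\eta(x,y)$. Cohomology: for $n>0$ let $X^n_\le=\{(x_0,\dots,x_{n-1})\in X^n: x_0\le\dots\le x_{n-1}\}$. For $n\ge0$ let $C^n(X,K)$ be the $K$-space of all functions $f:X^{n+1}_\le\to K$ and $C^n_\lambda(X,K)=\{f\in C^n(X,K): f(x_0,\dots,x_n)=0\text{ if }\lambda(x_0)\nleq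 x_n\}$. Define $\delta^n_{(\sigma,\lambda)}:C^n(X,K)\to C^{n+1}(X,K)$ by $$(\delta^n_{(\sigma,\lambda)}f)(x_0,\dots,x_{n+1})=\sigma(\lambda(x_0),\lambda(x_1))f(x_1,\dots,x_{n+1})+\sum_{i=1}^{n+1}(-1)^if(x_0,\dots,\widehat{x_i},\dots,x_{n+1}),$$ where $\widehat{x_i}$ means that $x_i$ is removed. These maps restrict to a cochain complex $C^0_\lambda(X,K)\to C^1_\lambda(X,K)\to\cdots$. For this complex, $Z^n_{(\sigma,\lambda)}(X,K)=\ker\delta^n_{(\sigma,\lambda)}\subseteq C^n_\lambda(X,K)$ for $n\ge0$, $B^n_{(\sigma,\lambda)}(X,K)=\delta^{n-1}_{(\sigma,\lambda)}(C^{n-1}_\lambda(X,K))$ for $n>0$, $H^n_{(\sigma,\lambda)}(X,K)=Z^n_{(\sigma,\lambda)}(X,K)/B^n_{(\sigma,\lambda)}(X,K)$ for $n>0$, and $H^0_{(\sigma,\lambda)}(X,K)=Z^0_{(\sigma,\lambda)}(X,K)$. *)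

theory Defs
  imports "HOL-Algebra.Module" "HOL-Algebra.AbelCoset"
begin

section \<open>Posets\<close>

text \<open>A poset is a carrier set \<open>X\<close> with an order relation \<open>r \<subseteq> X \<times> X\<close>, and \<open>(x, y) \<in> r\<close> reads
  as \<open>x \<le> y\<close>.\<close>

definition locally_finite_poset :: "'a set \<Rightarrow> 'a rel \<Rightarrow> bool" where
  "locally_finite_poset X r \<longleftrightarrow>
     partial_order_on X r \<and>
     (\<forall>x\<in>X. \<forall>y\<in>X. finite {z \<in> X. (x, z) \<in> r \<and> (z, y) \<in> r})"

text \<open>The values of an automorphism outside \<open>X\<close> are irrelevant.\<close>

definition poset_automorphism :: "'a set \<Rightarrow> 'a rel \<Rightarrow> ('a \<Rightarrow> 'a) \<Rightarrow> bool" where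
  "poset_automorphism X r l \<longleftrightarrow>
     bij_betw l X X \<and> (\<forall>x\<in>X. \<forall>y\<in>X. (x, y) \<in> r \<longleftrightarrow> (l x, l y) \<in> r)"


section \<open>Multiplicative elements of the incidence algebra\<close>

text \<open>Since \<open>r \<subseteq> X \<times> X\<close>, elements of the incidence algebra vanish off \<open>X \<times> X\<close> too. The
  convolution product plays no role below.\<close>

definition incidence_algebra :: "'a rel \<Rightarrow> ('a \<Rightarrow> 'a \<Rightarrow> 'k::field) set" where
  "incidence_algebra r = {f. \<forall>x y. (x, y) \<notin> r \<longrightarrow> f x y = 0}"

definition multiplicative_element :: "'a rel \<Rightarrow> ('a \<Rightarrow> 'a \<Rightarrow> 'k::field) \<Rightarrow> bool" where
  "multiplicative_element r \<sigma> \<longleftrightarrow>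
     \<sigma> \<in> incidence_algebra r \<and>
     (\<forall>x y. (x, y) \<in> r \<longrightarrow> \<sigma> x y \<noteq> 0) \<and>
     (\<forall>x y z. (x, y) \<in> r \<and> (y, z) \<in> r \<longrightarrow> \<sigma> x z = \<sigma> x y * \<sigma> y z)"

definition fractional_element :: "'a set \<Rightarrow> 'a rel \<Rightarrow> ('a \<Rightarrow> 'a \<Rightarrow> 'k::field) \<Rightarrow> bool" where
  "fractional_element X r \<eta> \<longleftrightarrow>
     multiplicative_element r \<eta> \<and>
     (\<exists>\<gamma>. (\<forall>x\<in>X. \<gamma> x \<noteq> 0) \<and> (\<forall>x y. (x, y) \<in> r \<longrightarrow> \<eta> x y = \<gamma> x * inverse (\<gamma> y)))"

definition equivalent_elements ::
    "'a set \<Rightarrow> 'a rel \<Rightarrow> ('a \<Rightarrow> 'a \<Rightarrow> 'k::field) \<Rightarrow> ('a \<Rightarrow> 'a \<Rightarrow> 'k) \<Rightarrow> bool" where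
  "equivalent_elements X r \<sigma> \<sigma>' \<longleftrightarrow>
     (\<exists>\<eta>. fractional_element X r \<eta> \<and> \<sigma>' = (\<lambda>x y. \<sigma> x y * \<eta> x y))"


section \<open>Vector spaces\<close>

text \<open>Vector spaces over a field type \<open>'k\<close> are HOL-Algebra \<open>module\<close> records, whose \<open>mult\<close> and
  \<open>one\<close> fields carry no meaning.\<close>

definition function_space :: "('b \<Rightarrow> 'k::field) set \<Rightarrow> ('k, 'b \<Rightarrow> 'k) module" where
  "function_space S =
     \<lparr>carrier = S, mult = undefined, one = undefined,
      zero = (\<lambda>_. 0), add = (\<lambda>f g x. f x + g x), smult = (\<lambda>c f x. c * f x)\<rparr>"

text \<open>The coset \<open>c \<cdot> (v + W) = c v + W\<close> is written as \<open>{c a + w | a \<in> v + W, w \<in> W}\<close>; adding \<open>W\<close>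
  again only matters for \<open>c = 0\<close>.\<close>

definition quotient_space ::
    "('k::field, 'v) module \<Rightarrow> 'v set \<Rightarrow> ('k, 'v set) module" where
  "quotient_space V W =
     \<lparr>carrier = a_rcosets\<^bsub>V\<^esub> W, mult = undefined, one = undefined,
      zero = W, add = (\<lambda>A B. A <+>\<^bsub>V\<^esub> B),
      smult = (\<lambda>c A. {(c \<odot>\<^bsub>V\<^esub> a) \<oplus>\<^bsub>V\<^esub> w | a w. a \<in> A \<and> w \<in> W})\<rparr>"

definition isomorphic_spaces ::
    "('k::field, 'v) module \<Rightarrow> ('k, 'w) module \<Rightarrow> bool" where
  "isomorphic_spaces V W \<longleftrightarrow>
     (\<exists>h \<in> iso (add_monoid V) (add_monoid W).
        \<forall>c. \<forall>v\<in>carrier V. h (c \<odot>\<^bsub>V\<^esub> v) = c \<odot>\<^bsub>W\<^esub> h v)"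


section \<open>Cohomology\<close>

text \<open>A tuple \<open>(x\<^sub>0, \<dots>, x\<^sub>n\<^sub>-\<^sub>1)\<close> is the list of its entries. As \<open>r\<close> is transitive,
  \<open>sorted_wrt\<close> says \<open>x\<^sub>0 \<le> \<dots> \<le> x\<^sub>n\<^sub>-\<^sub>1\<close>.\<close>

definition chains :: "'a set \<Rightarrow> 'a rel \<Rightarrow> nat \<Rightarrow> 'a list set" where
  "chains X r n = {xs. length xs = n \<and> set xs \<subseteq> X \<and> sorted_wrt (\<lambda>x y. (x, y) \<in> r) xs}"

text \<open>Functions on \<open>chains X r (n + 1)\<close> are represented by their extension by zero to all lists.\<close>

definition cochains :: "'a set \<Rightarrow> 'a rel \<Rightarrow> nat \<Rightarrow> ('a list \<Rightarrow> 'k::field) set" where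
  "cochains X r n = {f. \<forall>xs. xs \<notin> chains X r (n + 1) \<longrightarrow> f xs = 0}"

definition restricted_cochains ::
    "'a set \<Rightarrow> 'a rel \<Rightarrow> ('a \<Rightarrow> 'a) \<Rightarrow> nat \<Rightarrow> ('a list \<Rightarrow> 'k::field) set" where
  "restricted_cochains X r l n =
     {f \<in> cochains X r n. \<forall>xs \<in> chains X r (n + 1). (l (xs ! 0), xs ! n) \<notin> r \<longrightarrow> f xs = 0}"

definition coboundary ::
    "'a set \<Rightarrow> 'a rel \<Rightarrow> ('a \<Rightarrow> 'a \<Rightarrow> 'k::field) \<Rightarrow> ('a \<Rightarrow> 'a) \<Rightarrow> nat
      \<Rightarrow> ('a list \<Rightarrow> 'k) \<Rightarrow> 'a list \<Rightarrow> 'k" where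
  "coboundary X r \<sigma> l n f xs =
     (if xs \<in> chains X r (n + 2)
      then \<sigma> (l (xs ! 0)) (l (xs ! 1)) * f (tl xs)
           + (\<Sum>i = 1..n + 1. (- 1) ^ i * f (take i xs @ drop (i + 1) xs))
      else 0)"

definition cocycles ::
    "'a set \<Rightarrow> 'a rel \<Rightarrow> ('a \<Rightarrow> 'a \<Rightarrow> 'k::field) \<Rightarrow> ('a \<Rightarrow> 'a) \<Rightarrow> nat \<Rightarrow> ('a list \<Rightarrow> 'k) set" where
  "cocycles X r \<sigma> l n =
     {f \<in> restricted_cochains X r l n. coboundary X r \<sigma> l n f = (\<lambda>_. 0)}"

text \<open>Only meaningful for \<open>n > 0\<close>.\<close>

definition coboundaries ::
    "'a set \<Rightarrow> 'a rel \<Rightarrow> ('a \<Rightarrow> 'a \<Rightarrow> 'k::field) \<Rightarrow> ('a \<Rightarrow> 'a) \<Rightarrow> nat \<Rightarrow> ('a list \<Rightarrow> 'k) set" where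
  "coboundaries X r \<sigma> l n = coboundary X r \<sigma> l (n - 1) ` restricted_cochains X r l (n - 1)"

text \<open>\<open>H\<^sup>0\<close> is a space of functions while \<open>H\<^sup>n\<close> for \<open>n > 0\<close> is a space of cosets of functions, so
  they have different types.\<close>

definition cohomology_zero ::
    "'a set \<Rightarrow> 'a rel \<Rightarrow> ('a \<Rightarrow> 'a \<Rightarrow> 'k::field) \<Rightarrow> ('a \<Rightarrow> 'a) \<Rightarrow> ('k, 'a list \<Rightarrow> 'k) module" where
  "cohomology_zero X r \<sigma> l = function_space (cocycles X r \<sigma> l 0)"

definition cohomology_pos ::
    "'a set \<Rightarrow> 'a rel \<Rightarrow> ('a \<Rightarrow> 'a \<Rightarrow> 'k::field) \<Rightarrow> ('a \<Rightarrow> 'a) \<Rightarrow> nat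
      \<Rightarrow> ('k, ('a list \<Rightarrow> 'k) set) module" where
  "cohomology_pos X r \<sigma> l n =
     quotient_space (function_space (cocycles X r \<sigma> l n)) (coboundaries X r \<sigma> l n)"

end

theory Submission
  imports Defs
begin

text \<open>Let \<open>\<gamma>\<close> witness the equivalence, so that \<open>\<sigma>' x y = \<sigma> x y * \<gamma> x / \<gamma> y\<close>. In the coboundary
  of a cochain at \<open>(x\<^sub>0, \<dots>, x\<^sub>n\<^sub>+\<^sub>1)\<close>, every face but the zeroth keeps the initial vertex \<open>x\<^sub>0\<close>,
  and the zeroth, whose initial vertex is \<open>x\<^sub>1\<close>, enters with the coefficient
  \<open>\<sigma> (l x\<^sub>0) (l x\<^sub>1)\<close>. Multiplying each cochain by the value of \<open>\<gamma> \<circ> l\<close> at the initial vertex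
  therefore turns the coboundary for \<open>\<sigma>\<close> into the one for \<open>\<sigma>'\<close>, because
  \<open>\<sigma>' (l x\<^sub>0) (l x\<^sub>1) * \<gamma> (l x\<^sub>1) = \<gamma> (l x\<^sub>0) * \<sigma> (l x\<^sub>0) (l x\<^sub>1)\<close>
  (\<open>coboundary_rescale\<close>). The weight never vanishes, so this multiplication is a linear
  automorphism of the restricted cochains, with inverse the multiplication by the reciprocal
  weight. It carries cocycles onto cocycles and coboundaries onto coboundaries, and so induces
  isomorphisms of the cohomology spaces.\<close>

section \<open>Linear injections and quotients of function spaces\<close>

text \<open>The induced map on cosets is taking images under \<open>\<phi>\<close>. Linearity makes images commute with
  the set operations from which cosets, their sums and their multiples are built, and injectivity
  of \<open>\<phi>\<close> on functions makes taking images injective on sets of functions.\<close>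

lemma isomorphic_quotient_spaces_image:
  fixes \<phi> :: "('b \<Rightarrow> 'k::field) \<Rightarrow> ('c \<Rightarrow> 'k)"
  assumes add: "\<And>f g. \<phi> (\<lambda>x. f x + g x) = (\<lambda>x. \<phi> f x + \<phi> g x)"
    and smult: "\<And>c f. \<phi> (\<lambda>x. c * f x) = (\<lambda>x. c * \<phi> f x)"
    and inj: "inj \<phi>"
  shows "isomorphic_spaces (quotient_space (function_space Z) B)
           (quotient_space (function_space (\<phi> ` Z)) (\<phi> ` B))"
proof -
  let ?V = "quotient_space (function_space Z) B"
  let ?W = "quotient_space (function_space (\<phi> ` Z)) (\<phi> ` B)"
  have carrier: "carrier (quotient_space (function_space S) C)
      = (\<lambda>v. (\<lambda>b x. b x + v x) ` C) ` S" for S C :: "('d \<Rightarrow> 'k) set"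
    by (auto simp: quotient_space_def function_space_def A_RCOSETS_def RCOSETS_def r_coset_def
        image_def)
  have sum: "A \<oplus>\<^bsub>quotient_space (function_space S) C\<^esub> A'
      = {(\<lambda>x. a x + a' x) |a a'. a \<in> A \<and> a' \<in> A'}"
    for S C A A' :: "('d \<Rightarrow> 'k) set"
    by (auto simp: quotient_space_def function_space_def set_add_def set_mult_def)
  have multiple: "c \<odot>\<^bsub>quotient_space (function_space S) C\<^esub> A
      = {(\<lambda>x. c * a x + w x) |a w. a \<in> A \<and> w \<in> C}" for c and S C A :: "('d \<Rightarrow> 'k) set"
    by (auto simp: quotient_space_def function_space_def)
  have coset: "\<phi> ` (\<lambda>b x. b x + v x) ` B = (\<lambda>b x. b x + \<phi> v x) ` \<phi> ` B" for v
    by (simp add: image_image add)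
  have carrier_image: "(`) \<phi> ` carrier ?V = carrier ?W"
    by (simp add: carrier image_image coset[unfolded image_image])
  have bij: "bij_betw ((`) \<phi>) (carrier ?V) (carrier ?W)"
    using carrier_image inj by (auto simp: bij_betw_def inj_on_def inj_image_eq_iff)
  have hom: "\<phi> ` (A \<oplus>\<^bsub>?V\<^esub> A') = \<phi> ` A \<oplus>\<^bsub>?W\<^esub> \<phi> ` A'" for A A'
  proof -
    have "\<phi> ` {(\<lambda>x. a x + a' x) |a a'. a \<in> A \<and> a' \<in> A'}
        = {\<phi> (\<lambda>x. a x + a' x) |a a'. a \<in> A \<and> a' \<in> A'}"
      by blast
    then show ?thesis
      unfolding sum add by blast
  qed
  have scalar: "\<phi> ` (c \<odot>\<^bsub>?V\<^esub> A) = c \<odot>\<^bsub>?W\<^esub> \<phi> ` A" for c A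
  proof -
    have "\<phi> ` {(\<lambda>x. c * a x + w x) |a w. a \<in> A \<and> w \<in> B}
        = {\<phi> (\<lambda>x. c * a x + w x) |a w. a \<in> A \<and> w \<in> B}"
      by blast
    then show ?thesis
      unfolding multiple add smult by blast
  qed
  have "(`) \<phi> \<in> iso (add_monoid ?V) (add_monoid ?W)"
    using bij hom by (auto simp: iso_def hom_def bij_betw_def)
  then show ?thesis
    unfolding isomorphic_spaces_def using scalar by blast
qed

lemma isomorphic_function_spaces_image:
  fixes \<phi> :: "('b \<Rightarrow> 'k::field) \<Rightarrow> ('c \<Rightarrow> 'k)"
  assumes "\<And>f g. \<phi> (\<lambda>x. f x + g x) = (\<lambda>x. \<phi> f x + \<phi> g x)"
    and "\<And>c f. \<phi> (\<lambda>x. c * f x) = (\<lambda>x. c * \<phi> f x)"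
    and "inj \<phi>"
  shows "isomorphic_spaces (function_space Z) (function_space (\<phi> ` Z))"
proof -
  have "\<phi> \<in> iso (add_monoid (function_space Z)) (add_monoid (function_space (\<phi> ` Z)))"
    using assms by (auto simp: iso_def hom_def function_space_def bij_betw_def inj_on_def)
  then show ?thesis
    unfolding isomorphic_spaces_def using assms(2) by (auto simp: function_space_def)
qed

section \<open>Weighting cochains by their initial vertex\<close>

definition rescale :: "('a \<Rightarrow> 'k::field) \<Rightarrow> ('a list \<Rightarrow> 'k) \<Rightarrow> 'a list \<Rightarrow> 'k" where
  "rescale w f = (\<lambda>xs. w (xs ! 0) * f xs)"

lemma rescale_inverse:
  assumes "\<And>x. w x \<noteq> 0"
  shows "rescale w (rescale (\<lambda>x. inverse (w x)) f) = f"
    and "rescale (\<lambda>x. inverse (w x)) (rescale w f) = f"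
  using assms by (simp_all add: rescale_def mult.assoc[symmetric])

lemma inj_rescale:
  assumes "\<And>x. w x \<noteq> 0"
  shows "inj (rescale w)"
  using rescale_inverse(2)[of w] assms by (metis injI)

lemma rescale_eq_zero_iff:
  assumes "\<And>x. w x \<noteq> 0"
  shows "rescale w f = (\<lambda>_. 0) \<longleftrightarrow> f = (\<lambda>_. 0)"
  using assms by (simp add: rescale_def fun_eq_iff)

lemma rescale_restricted_cochains:
  "f \<in> restricted_cochains X r l n \<Longrightarrow> rescale w f \<in> restricted_cochains X r l n"
  by (auto simp: restricted_cochains_def cochains_def rescale_def)

lemma rescale_image_restricted_cochains:
  assumes "\<And>x. w x \<noteq> 0"
  shows "rescale w ` restricted_cochains X r l n = restricted_cochains X r l n"
proof
  show "restricted_cochains X r l n \<subseteq> rescale w ` restricted_cochains X r l n"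
    using rescale_inverse(1)[of w] assms rescale_restricted_cochains by (metis image_eqI subsetI)
qed (auto intro: rescale_restricted_cochains)

text \<open>Only the zeroth face has a new initial vertex, so only there does the weight change, from
  that of \<open>x\<close> to that of \<open>y\<close>; \<open>twist\<close> says that replacing \<open>\<sigma>\<close> by \<open>\<sigma>'\<close> makes up for this.\<close>

lemma coboundary_rescale:
  assumes twist: "\<And>x y. \<lbrakk>x \<in> X; y \<in> X; (x, y) \<in> r\<rbrakk> \<Longrightarrow> \<sigma>' (l x) (l y) * w y = w x * \<sigma> (l x) (l y)"
  shows "coboundary X r \<sigma>' l n (rescale w f) = rescale w (coboundary X r \<sigma> l n f)"
proof
  fix xs
  show "coboundary X r \<sigma>' l n (rescale w f) xs = rescale w (coboundary X r \<sigma> l n f) xs"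
  proof (cases "xs \<in> chains X r (n + 2)")
    case True
    then obtain x y ys where xs: "xs = x # y # ys"
      by (auto simp: chains_def length_Suc_conv)
    with True have "x \<in> X" "y \<in> X" "(x, y) \<in> r"
      by (auto simp: chains_def)
    then have "\<sigma>' (l x) (l y) * (w y * f (y # ys)) = w x * (\<sigma> (l x) (l y) * f (y # ys))"
      using twist by (simp add: mult.assoc[symmetric])
    moreover have "(\<Sum>i = 1..n + 1. (- 1) ^ i * rescale w f (take i xs @ drop (i + 1) xs))
        = w x * (\<Sum>i = 1..n + 1. (- 1) ^ i * f (take i xs @ drop (i + 1) xs))"
      unfolding sum_distrib_left
    proof (rule sum.cong)
      fix i
      assume "i \<in> {1..n + 1}"
      then have "(take i xs @ drop (i + 1) xs) ! 0 = x"
        using xs by (cases i) auto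
      then show "(- 1) ^ i * rescale w f (take i xs @ drop (i + 1) xs)
          = w x * ((- 1) ^ i * f (take i xs @ drop (i + 1) xs))"
        by (simp add: rescale_def mult.left_commute)
    qed simp
    ultimately show ?thesis
      using True xs by (simp add: coboundary_def rescale_def distrib_left)
  next
    case False
    then show ?thesis
      by (simp add: coboundary_def rescale_def)
  qed
qed

lemma cocycles_rescale:
  assumes w: "\<And>x. w x \<noteq> 0"
    and twist: "\<And>x y. \<lbrakk>x \<in> X; y \<in> X; (x, y) \<in> r\<rbrakk> \<Longrightarrow> \<sigma>' (l x) (l y) * w y = w x * \<sigma> (l x) (l y)"
  shows "cocycles X r \<sigma>' l n = rescale w ` cocycles X r \<sigma> l n"
proof -
  have "coboundary X r \<sigma>' l n (rescale w f) = (\<lambda>_. 0) \<longleftrightarrow> coboundary X r \<sigma> l n f = (\<lambda>_. 0)" for f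
    by (simp only: coboundary_rescale[where \<sigma> = \<sigma> and \<sigma>' = \<sigma>' and w = w, OF twist]
        rescale_eq_zero_iff[OF w])
  then show ?thesis
    unfolding cocycles_def
    by (subst rescale_image_restricted_cochains[where w = w, OF w, symmetric]) auto
qed

lemma coboundaries_rescale:
  assumes w: "\<And>x. w x \<noteq> 0"
    and twist: "\<And>x y. \<lbrakk>x \<in> X; y \<in> X; (x, y) \<in> r\<rbrakk> \<Longrightarrow> \<sigma>' (l x) (l y) * w y = w x * \<sigma> (l x) (l y)"
  shows "coboundaries X r \<sigma>' l n = rescale w ` coboundaries X r \<sigma> l n"
  unfolding coboundaries_def
  by (subst rescale_image_restricted_cochains[where w = w, OF w, symmetric])
    (simp only: image_image coboundary_rescale[where \<sigma> = \<sigma> and \<sigma>' = \<sigma>' and w = w, OF twist])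

section \<open>Invariance of cohomology under equivalence\<close>

lemma equivalent_elements_weight:
  fixes \<sigma> \<sigma>' :: "'a \<Rightarrow> 'a \<Rightarrow> 'k::field"
  assumes "equivalent_elements X r \<sigma> \<sigma>'"
  obtains \<gamma> where "\<And>x. \<gamma> x \<noteq> 0"
    and "\<And>x y. \<lbrakk>x \<in> X; y \<in> X; (x, y) \<in> r\<rbrakk> \<Longrightarrow> \<sigma>' x y * \<gamma> y = \<gamma> x * \<sigma> x y"
proof -
  from assms obtain \<eta> \<gamma> where \<gamma>: "\<forall>x\<in>X. \<gamma> x \<noteq> 0"
    and \<eta>: "\<forall>x y. (x, y) \<in> r \<longrightarrow> \<eta> x y = \<gamma> x * inverse (\<gamma> y)"
    and \<sigma>': "\<sigma>' = (\<lambda>x y. \<sigma> x y * \<eta> x y)"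
    unfolding equivalent_elements_def fractional_element_def by blast
  \<comment> \<open>The value 1 off \<open>X\<close> makes the weight invertible on all lists, not only on chains.\<close>
  define \<gamma>' where "\<gamma>' x = (if x \<in> X then \<gamma> x else 1)" for x
  show thesis
  proof (rule that)
    show "\<gamma>' x \<noteq> 0" for x
      using \<gamma> by (simp add: \<gamma>'_def)
    show "\<sigma>' x y * \<gamma>' y = \<gamma>' x * \<sigma> x y" if "x \<in> X" "y \<in> X" "(x, y) \<in> r" for x y
      using that \<gamma> \<eta> by (simp add: \<gamma>'_def \<sigma>' field_simps)
  qed
qed

theorem proposition3p12:
  fixes X :: "'a set" and r :: "'a rel" and l :: "'a \<Rightarrow> 'a"
    and \<sigma> \<sigma>' :: "'a \<Rightarrow> 'a \<Rightarrow> 'k::field"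
  assumes "locally_finite_poset X r"
    and "poset_automorphism X r l"
    and "multiplicative_element r \<sigma>"
    and "multiplicative_element r \<sigma>'"
    and "equivalent_elements X r \<sigma> \<sigma>'"
  shows "isomorphic_spaces (cohomology_zero X r \<sigma> l) (cohomology_zero X r \<sigma>' l)
    \<and> (\<forall>n>0. isomorphic_spaces (cohomology_pos X r \<sigma> l n) (cohomology_pos X r \<sigma>' l n))"
proof -
  obtain \<gamma> where \<gamma>: "\<And>x. \<gamma> x \<noteq> 0"
    and \<gamma>_twist: "\<And>x y. \<lbrakk>x \<in> X; y \<in> X; (x, y) \<in> r\<rbrakk> \<Longrightarrow> \<sigma>' x y * \<gamma> y = \<gamma> x * \<sigma> x y"
    using equivalent_elements_weight[OF assms(5)] by blast
  define w where "w x = \<gamma> (l x)" for x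
  have w: "w x \<noteq> 0" for x
    by (simp add: w_def \<gamma>)
  have twist: "\<sigma>' (l x) (l y) * w y = w x * \<sigma> (l x) (l y)"
    if "x \<in> X" "y \<in> X" "(x, y) \<in> r" for x y
    using that assms(2) unfolding w_def poset_automorphism_def
    by (intro \<gamma>_twist) (auto simp: bij_betw_def)
  have add: "rescale w (\<lambda>x. f x + g x) = (\<lambda>x. rescale w f x + rescale w g x)" for f g
    by (simp add: rescale_def distrib_left)
  have smult: "rescale w (\<lambda>x. c * f x) = (\<lambda>x. c * rescale w f x)" for c f
    by (simp add: rescale_def mult.left_commute)
  have cocycles: "cocycles X r \<sigma>' l n = rescale w ` cocycles X r \<sigma> l n" for n
    using w twist by (rule cocycles_rescale)
  have coboundaries: "coboundaries X r \<sigma>' l n = rescale w ` coboundaries X r \<sigma> l n" for n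
    using w twist by (rule coboundaries_rescale)
  have "inj (rescale w)"
    using w by (rule inj_rescale)
  then show ?thesis
    unfolding cohomology_zero_def cohomology_pos_def cocycles coboundaries
    using isomorphic_function_spaces_image[where \<phi> = "rescale w", OF add smult]
      isomorphic_quotient_spaces_image[where \<phi> = "rescale w", OF add smult]
    by blast
qed

end
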